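(* Let $\alpha\in[0,1]$ and $\beta\in(0,1]$. For $n\ge3$, the star $K_{1,n-1}$ satisfies \[ \mathrm{Z}_{\alpha,\beta}(K_{1,n-1})=\begin{cases} n-2 & \text{if } \beta\le(n-2)\alpha^2,\\ n-1 & \text{if } (n-2)\alpha^2<\beta\le(n-1)\alpha,\\ n & \text{if } (n-1)\alpha<\beta.\end{cases} \]
   Context: All graphs are finite and simple. Let $\alpha,\beta$ be the transmission proportion and the transmission threshold, let $G$ be a graph and $B\subseteq V(G)$ a set of initially filled vertices. The transmission forcing process started from $B$ is defined as follows. Put $B_0=B$, $w_0(v)=1$ for $v\in B$ and $w_0(v)=0$ for $v\in V(G)\setminus B$. For $t\ge 1$, given the set $B_{t-1}$ of vertices filled at time $t-1$ and the weights $w_{t-1}$: for each unfilled vertex $u\in V(G)\setminus B_{t-1}$ let $\mathcal V_{t,u}$ be the set of all $v\in B_{t-1}$ such that $u$ is the only neighbor of $v$ in $V(G)\setminus B_{t-1}$ and $v\notin \mathcal V_{s,u'}$ for every $s<t$ and every $u'$ (each vertex transmits weight at most once); when $v\in\mathcal V_{t,u}$ we say $v$ forces $u$, written $v\to u$. Set $w_t(u)=w_{t-1}(u)+\sum_{v\in\mathcal V_{t,u}}\alpha\, w_{t-1}(v)$ for $u\in V(G)\setminus B_{t-1}$ and $w_t(u)=w_{t-1}(u)$ for $u\in B_{t-1}$. Then $B_t=B_{t-1}\cup\{u\in V(G)\setminus B_{t-1} : w_t(u)\ge\beta\}$. The set $B$ is an $(\alpha,\beta)$-transmission zero forcing set of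 $G$ if $B_t=V(G)$ for some $t\ge 0$, and the $(\alpha,\beta)$-transmission zero forcing number $\mathrm{Z}_{\alpha,\beta}(G)$ is the minimum cardinality of such a set. *)

theory Defs
  imports Complex_Main "Graph_Theory.Kuratowski"
begin

text \<open>
  Finite simple graphs are the instances of the locale \<^locale>\<open>graph\<close> (finite, loop-free, without
  parallel arcs, and symmetric: every edge is a pair of opposite arcs).  The neighbours of \<open>v\<close> are
  therefore the vertices \<open>x\<close> with \<open>v \<rightarrow>\<^bsub>G\<^esub> x\<close>.
\<close>

text \<open>
  The state of the process at time \<open>t\<close> consists of the set \<open>B\<^sub>t\<close>, the weights \<open>w\<^sub>t\<close>, and the set of all
  vertices that have forced some vertex at a time \<open>\<le> t\<close>.
\<close>

record 'a tf_state =
  filled :: "'a set"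
  weight :: "'a \<Rightarrow> real"
  spent :: "'a set"

text \<open>If \<open>S\<close> is the state at time \<open>t - 1\<close>, then \<open>forcers G S u\<close> is the set \<open>\<V>\<close> with index \<open>t, u\<close>.\<close>

definition forcers :: "('a,'b) pre_digraph \<Rightarrow> 'a tf_state \<Rightarrow> 'a \<Rightarrow> 'a set" where
  "forcers G S u =
     {v \<in> filled S. {x \<in> verts G - filled S. v \<rightarrow>\<^bsub>G\<^esub> x} = {u} \<and> v \<notin> spent S}"

definition next_weight ::
  "real \<Rightarrow> ('a,'b) pre_digraph \<Rightarrow> 'a tf_state \<Rightarrow> 'a \<Rightarrow> real" where
  "next_weight \<alpha> G S u =
     (if u \<in> verts G - filled S
      then weight S u + (\<Sum>v\<in>forcers G S u. \<alpha> * weight S v)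
      else weight S u)"

definition tf_step ::
  "real \<Rightarrow> real \<Rightarrow> ('a,'b) pre_digraph \<Rightarrow> 'a tf_state \<Rightarrow> 'a tf_state" where
  "tf_step \<alpha> \<beta> G S =
     \<lparr> filled = filled S \<union> {u \<in> verts G - filled S. next_weight \<alpha> G S u \<ge> \<beta>},
       weight = next_weight \<alpha> G S,
       spent = spent S \<union> (\<Union>u \<in> verts G - filled S. forcers G S u) \<rparr>"

primrec tf_process ::
  "real \<Rightarrow> real \<Rightarrow> ('a,'b) pre_digraph \<Rightarrow> 'a set \<Rightarrow> nat \<Rightarrow> 'a tf_state" where
  "tf_process \<alpha> \<beta> G B 0 =
     \<lparr> filled = B, weight = (\<lambda>v. if v \<in> B then 1 else 0), spent = {} \<rparr>"
| "tf_process \<alpha> \<beta> G B (Suc t) = tf_step \<alpha> \<beta> G (tf_process \<alpha> \<beta> G B t)"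

text \<open>
  By the following fact, the condition \<open>v \<notin> spent S\<close> in \<^const>\<open>forcers\<close> says that \<open>v\<close> has not forced
  any vertex at an earlier time (the forces of time \<open>s + 1\<close> are read off the state at time \<open>s\<close>).
\<close>

lemma spent_tf_process:
  "spent (tf_process \<alpha> \<beta> G B t) =
     (\<Union>s<t. \<Union>u \<in> verts G - filled (tf_process \<alpha> \<beta> G B s). forcers G (tf_process \<alpha> \<beta> G B s) u)"
  by (induction t) (auto simp: tf_step_def lessThan_Suc)

definition transmission_zero_forcing_set ::
  "real \<Rightarrow> real \<Rightarrow> ('a,'b) pre_digraph \<Rightarrow> 'a set \<Rightarrow> bool" where
  "transmission_zero_forcing_set \<alpha> \<beta> G B \<longleftrightarrow>
     B \<subseteq> verts G \<and> (\<exists>t. filled (tf_process \<alpha> \<beta> G B t) = verts G)"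

text \<open>
  For a finite graph the minimum is over a finite nonempty set, since \<open>verts G\<close> itself is always a
  transmission zero forcing set.
\<close>

definition transmission_zero_forcing_number ::
  "real \<Rightarrow> real \<Rightarrow> ('a,'b) pre_digraph \<Rightarrow> nat" where
  "transmission_zero_forcing_number \<alpha> \<beta> G =
     Min (card ` {B. transmission_zero_forcing_set \<alpha> \<beta> G B})"

end

theory Submission
  imports Defs
begin

text \<open>
  A leaf of a star is filled only by the centre, which forces only when exactly one leaf is unfilled.
  So a forcing set misses at most one leaf, and apart from the whole vertex set only three kinds of
  sets remain.  All leaves: the centre receives weight \<open>(n - 1) \<alpha>\<close>.  All vertices but one leaf: the
  leaf receives \<open>\<alpha>\<close>, which is at most \<open>(n - 1) \<alpha>\<close>.  All leaves but one: the centre receives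
  \<open>(n - 2) \<alpha>\<close> and, if this fills it, passes \<open>(n - 2) \<alpha>\<^sup>2\<close> on to the last leaf.
\<close>

section \<open>The transmission forcing process\<close>

lemma forcers_subset: "forcers G S u \<subseteq> filled S - spent S"
  by (auto simp: forcers_def)

lemma tf_process_fixpoint:
  assumes "tf_step \<alpha> \<beta> G (tf_process \<alpha> \<beta> G B k) = tf_process \<alpha> \<beta> G B k"
  shows "tf_process \<alpha> \<beta> G B (k + t) = tf_process \<alpha> \<beta> G B k"
  using assms by (induction t) auto

lemma filled_tf_process_mono:
  "s \<le> t \<Longrightarrow> filled (tf_process \<alpha> \<beta> G B s) \<subseteq> filled (tf_process \<alpha> \<beta> G B t)"
  by (rule lift_Suc_mono_le[of "\<lambda>t. filled (tf_process \<alpha> \<beta> G B t)"]) (auto simp: tf_step_def)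

lemma filled_tf_process_subset:
  "B \<subseteq> verts G \<Longrightarrow> filled (tf_process \<alpha> \<beta> G B t) \<subseteq> verts G"
  by (induction t) (auto simp: tf_step_def)

lemma transmission_zero_forcing_setI:
  assumes "B \<subseteq> verts G" "verts G \<subseteq> filled (tf_process \<alpha> \<beta> G B t)"
  shows "transmission_zero_forcing_set \<alpha> \<beta> G B"
  using assms filled_tf_process_subset[of B G \<alpha> \<beta> t]
  by (auto simp: transmission_zero_forcing_set_def)

text \<open>Without forcers no weight changes, so a vertex could only be filled because its old
  weight already reaches \<open>\<beta>\<close>. The second assumption excludes this, as
  \<open>S\<close> is an arbitrary state.\<close>

lemma tf_step_no_forcers:
  assumes "\<And>u. u \<in> verts G - filled S \<Longrightarrow> forcers G S u = {}"
    and "\<And>u. u \<in> verts G - filled S \<Longrightarrow> weight S u < \<beta>"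
  shows "tf_step \<alpha> \<beta> G S = S"
proof -
  have "next_weight \<alpha> G S = weight S"
    using assms(1) by (auto simp: next_weight_def fun_eq_iff)
  moreover have "{u \<in> verts G - filled S. weight S u \<ge> \<beta>} = {}"
    using assms(2) by fastforce
  moreover from calculation have "filled (tf_step \<alpha> \<beta> G S) = filled S"
    by (simp only: tf_step_def tf_state.simps Un_empty_right)
  moreover have "spent (tf_step \<alpha> \<beta> G S) = spent S"
    using assms(1) by (auto simp: tf_step_def)
  ultimately show ?thesis
    by (intro tf_state.equality) (simp_all add: tf_step_def)
qed

text \<open>A state without forcers repeats forever. Since filled sets only grow, a vertex unfilled
  at time \<open>k\<close> was also unfilled at all earlier times; comparing time \<open>t\<close>
  with time \<open>k + t\<close> covers \<open>t < k\<close> as well.\<close>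

lemma not_transmission_zero_forcing_set:
  assumes "\<And>u. u \<in> verts G - filled (tf_process \<alpha> \<beta> G B k) \<Longrightarrow>
             forcers G (tf_process \<alpha> \<beta> G B k) u = {}"
    and "\<And>u. u \<in> verts G - filled (tf_process \<alpha> \<beta> G B k) \<Longrightarrow>
             weight (tf_process \<alpha> \<beta> G B k) u < \<beta>"
    and x: "x \<in> verts G" "x \<notin> filled (tf_process \<alpha> \<beta> G B k)"
  shows "\<not> transmission_zero_forcing_set \<alpha> \<beta> G B"
proof
  assume "transmission_zero_forcing_set \<alpha> \<beta> G B"
  then obtain t where "filled (tf_process \<alpha> \<beta> G B t) = verts G"
    by (auto simp: transmission_zero_forcing_set_def)
  moreover have "filled (tf_process \<alpha> \<beta> G B t) \<subseteq> filled (tf_process \<alpha> \<beta> G B (k + t))"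
    by (rule filled_tf_process_mono) simp
  moreover have "tf_process \<alpha> \<beta> G B (k + t) = tf_process \<alpha> \<beta> G B k"
    by (intro tf_process_fixpoint tf_step_no_forcers assms)
  ultimately show False
    using x by auto
qed

lemma transmission_zero_forcing_set_verts:
  "transmission_zero_forcing_set \<alpha> \<beta> G (verts G)"
  by (rule transmission_zero_forcing_setI[where t = 0]) auto

text \<open>Every neighbour of \<open>u\<close> starts with weight 1 and has \<open>u\<close> as its
  only unfilled neighbour, so all of them force \<open>u\<close> in the first step. They are then
  spent, hence this single transmission decides. For stars, \<open>u\<close> will be the centre or a
  leaf.\<close>

lemma transmission_zero_forcing_set_all_but_one:
  assumes "u \<in> verts G" "0 < \<beta>"
  shows "transmission_zero_forcing_set \<alpha> \<beta> G (verts G - {u}) \<longleftrightarrow>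
    \<beta> \<le> \<alpha> * card {v \<in> verts G - {u}. v \<rightarrow>\<^bsub>G\<^esub> u}"
proof -
  let ?B = "verts G - {u}" and ?N = "{v \<in> verts G - {u}. v \<rightarrow>\<^bsub>G\<^esub> u}"
  let ?S = "tf_process \<alpha> \<beta> G ?B"
  have un: "verts G - ?B = {u}"
    using assms by auto
  have f0: "forcers G (?S 0) u = ?N"
    using assms by (auto simp: forcers_def)
  have w1: "weight (?S 1) u = \<alpha> * card ?N"
    using assms f0 by (simp add: tf_step_def next_weight_def)
  have filled1: "filled (?S 1) = ?B \<union> (if \<beta> \<le> \<alpha> * card ?N then {u} else {})"
    using assms w1 un by (auto simp: tf_step_def)
  have spent1: "spent (?S 1) = ?N"
    using f0 un by (simp add: tf_step_def)
  show ?thesis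
  proof (cases "\<beta> \<le> \<alpha> * card ?N")
    case True
    then show ?thesis
      using filled1 by (intro iffI transmission_zero_forcing_setI[where t = 1]) auto
  next
    case False
    then have filled1': "filled (?S 1) = ?B"
      using filled1 by simp
    have "\<not> transmission_zero_forcing_set \<alpha> \<beta> G ?B"
    proof (rule not_transmission_zero_forcing_set[where k = 1 and x = u])
      fix y assume "y \<in> verts G - filled (?S 1)"
      then have "y = u"
        using filled1' by auto
      then show "forcers G (?S 1) y = {}" "weight (?S 1) y < \<beta>"
        using False w1 filled1' spent1 by (auto simp: forcers_def)
    qed (use assms filled1' in auto)
    with False show ?thesis
      by simp
  qed
qed

lemma transmission_zero_forcing_number_eqI:
  assumes "finite (verts G)"
    and "transmission_zero_forcing_set \<alpha> \<beta> G B" "card B = k"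
    and "\<And>B. transmission_zero_forcing_set \<alpha> \<beta> G B \<Longrightarrow> k \<le> card B"
  shows "transmission_zero_forcing_number \<alpha> \<beta> G = k"
proof -
  have "finite {B. transmission_zero_forcing_set \<alpha> \<beta> G B}"
    using assms(1)
    by (rule rev_finite_subset[OF finite_Pow_iff[THEN iffD2]])
       (auto simp: transmission_zero_forcing_set_def)
  then show ?thesis
    unfolding transmission_zero_forcing_number_def using assms by (intro Min_eqI) auto
qed

section \<open>Stars\<close>

text \<open>The complete bipartite digraph with one side a singleton, restated with the centre named
  so that adjacency can be computed from \<open>arcs_ends\<close> alone.\<close>

locale star_digraph =
  fixes G :: "('a,'b) pre_digraph" and c :: 'a and L :: "'a set"
  assumes centre_notin: "c \<notin> L"
    and verts_eq: "verts G = insert c L"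
    and arcs_ends_eq: "arcs_ends G = {c} \<times> L \<union> L \<times> {c}"
begin

text \<open>Leaves receive weight only from the centre, which cannot force while two leaves are unfilled.\<close>

lemma two_empty_leaves_stuck:
  assumes "x \<in> L - B" "y \<in> L - B" "x \<noteq> y" "0 < \<beta>"
  shows "L - filled (tf_process \<alpha> \<beta> G B t) = L - B \<and>
    (\<forall>u\<in>L - B. weight (tf_process \<alpha> \<beta> G B t) u = 0)"
proof (induction t)
  case 0
  then show ?case
    by simp
next
  case (Suc t)
  let ?S = "tf_process \<alpha> \<beta> G B t"
  have L: "L - filled ?S = L - B"
    using Suc by simp
  have "next_weight \<alpha> G ?S u = 0" if u: "u \<in> L - B" for u
  proof -
    have "forcers G ?S u = {}"
    proof (rule ccontr)
      assume "forcers G ?S u \<noteq> {}"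
      then obtain v where v: "{x \<in> verts G - filled ?S. v \<rightarrow>\<^bsub>G\<^esub> x} = {u}"
        by (auto simp: forcers_def)
      then have "(v, u) \<in> arcs_ends G"
        by blast
      then have "v = c"
        using u centre_notin by (auto simp: arcs_ends_eq)
      \<comment> \<open>By the induction hypothesis the centre still sees both \<open>x\<close> and
        \<open>y\<close> unfilled, so its unfilled neighbours do not form a singleton.\<close>
      then have "{x \<in> verts G - filled ?S. v \<rightarrow>\<^bsub>G\<^esub> x} = L - B"
        using L centre_notin by (auto simp: arcs_ends_eq verts_eq)
      then show False
        using v assms by auto
    qed
    then show ?thesis
      using Suc u by (simp add: next_weight_def)
  qed
  \<comment> \<open>A leaf of weight 0 stays below the positive threshold \<open>\<beta>\<close>;
    this is why the invariant records weights along with filled sets.\<close>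
  then show ?case
    using L \<open>0 < \<beta>\<close> by (fastforce simp: tf_step_def)
qed

lemma transmission_zero_forcing_set_misses_one_leaf:
  assumes "transmission_zero_forcing_set \<alpha> \<beta> G B" "0 < \<beta>" "x \<in> L - B" "y \<in> L - B"
  shows "x = y"
proof (rule ccontr)
  assume "x \<noteq> y"
  obtain t where "filled (tf_process \<alpha> \<beta> G B t) = verts G"
    using assms(1) by (auto simp: transmission_zero_forcing_set_def)
  then show False
    using two_empty_leaves_stuck[OF assms(3,4) \<open>x \<noteq> y\<close> assms(2), of \<alpha> t] assms(3)
    by (auto simp: verts_eq)
qed

text \<open>Two independent choices remain: whether one leaf is missing, and whether the centre
  is.\<close>

lemma transmission_zero_forcing_set_cases:
  assumes "transmission_zero_forcing_set \<alpha> \<beta> G B" "0 < \<beta>"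
  obtains "B = verts G" | "B = L" | x where "x \<in> L" "B = verts G - {x}"
    | x where "x \<in> L" "B = L - {x}"
proof -
  have B: "B \<subseteq> insert c L"
    using assms(1) by (simp add: transmission_zero_forcing_set_def verts_eq)
  show thesis
  proof (cases "L \<subseteq> B")
    case True
    then have "B = verts G \<or> B = L"
      using B centre_notin by (auto simp: verts_eq)
    then show thesis
      using that by blast
  next
    case False
    then obtain x where x: "x \<in> L - B"
      by blast
    then have "L - B = {x}"
      using transmission_zero_forcing_set_misses_one_leaf[OF assms] by blast
    then have "B = verts G - {x} \<or> B = L - {x}"
      using B centre_notin by (auto simp: verts_eq)
    then show thesis
      using that x by blast
  qed
qed

section \<open>Thresholds for the three kinds of proper candidate sets\<close>

lemma transmission_zero_forcing_set_leaves:
  assumes "0 < \<beta>"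
  shows "transmission_zero_forcing_set \<alpha> \<beta> G L \<longleftrightarrow> \<beta> \<le> \<alpha> * card L"
proof -
  have "verts G - {c} = L" "{v \<in> verts G - {c}. v \<rightarrow>\<^bsub>G\<^esub> c} = L"
    using centre_notin by (auto simp: verts_eq arcs_ends_eq)
  then show ?thesis
    using transmission_zero_forcing_set_all_but_one[of c G \<beta> \<alpha>] assms by (simp add: verts_eq)
qed

lemma transmission_zero_forcing_set_all_but_leaf:
  assumes "x \<in> L" "0 < \<beta>"
  shows "transmission_zero_forcing_set \<alpha> \<beta> G (verts G - {x}) \<longleftrightarrow> \<beta> \<le> \<alpha>"
proof -
  have "{v \<in> verts G - {x}. v \<rightarrow>\<^bsub>G\<^esub> x} = {c}"
    using assms centre_notin by (auto simp: verts_eq arcs_ends_eq)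
  then show ?thesis
    using transmission_zero_forcing_set_all_but_one[of x G \<beta> \<alpha>] assms by (simp add: verts_eq)
qed

text \<open>The filled leaves pass \<open>\<alpha> * ?m\<close> to the centre at time 1; if that
  fills it, the centre passes on \<open>\<alpha>\<close> times this weight at time 2. As
  \<open>\<alpha> \<le> 1\<close>, the second threshold implies the first, so one inequality
  suffices.\<close>

lemma transmission_zero_forcing_set_leaves_but_one:
  assumes x: "x \<in> L" and "0 \<le> \<alpha>" "\<alpha> \<le> 1" "0 < \<beta>"
  shows "transmission_zero_forcing_set \<alpha> \<beta> G (L - {x}) \<longleftrightarrow> \<beta> \<le> \<alpha>\<^sup>2 * card (L - {x})"
proof -
  let ?B = "L - {x}"
  let ?S = "tf_process \<alpha> \<beta> G ?B" and ?m = "real (card (L - {x}))"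
  have "c \<noteq> x"
    using x centre_notin by auto
  have un: "verts G - ?B = {c, x}"
    using x centre_notin by (auto simp: verts_eq)
  have out_c: "{y \<in> {c, x}. v \<rightarrow>\<^bsub>G\<^esub> y} = {c}" if "v \<in> ?B" for v
    using that x centre_notin by (auto simp: arcs_ends_eq)
  have f0: "forcers G (?S 0) c = ?B" "forcers G (?S 0) x = {}"
    using out_c \<open>c \<noteq> x\<close> by (auto simp: forcers_def un)
  have w0: "weight (?S 0) c = 0" "weight (?S 0) x = 0"
    using centre_notin by auto
  have n0: "next_weight \<alpha> G (?S 0) c = \<alpha> * ?m" "next_weight \<alpha> G (?S 0) x = 0"
    using f0 un w0 by (auto simp: next_weight_def mult.commute)
  have w1: "weight (?S 1) c = \<alpha> * ?m" "weight (?S 1) x = 0"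
    using n0 by (auto simp: tf_step_def)
  \<comment> \<open>The leaf \<open>x\<close> has weight 0 < \<open>\<beta>\<close>, so only the
    centre can be filled now.\<close>
  have filled1: "filled (?S 1) = ?B \<union> (if \<beta> \<le> \<alpha> * ?m then {c} else {})"
    using n0 un \<open>0 < \<beta>\<close> by (auto simp: tf_step_def)
  have spent1: "spent (?S 1) = ?B"
    using f0 un by (simp add: tf_step_def)
  show ?thesis
  proof (cases "\<beta> \<le> \<alpha> * ?m")
    case False
    then have filled1': "filled (?S 1) = ?B"
      using filled1 by simp
    have "\<not> transmission_zero_forcing_set \<alpha> \<beta> G ?B"
    proof (rule not_transmission_zero_forcing_set[where k = 1 and x = x])
      fix y assume "y \<in> verts G - filled (?S 1)"
      then have "y \<in> {c, x}"
        unfolding filled1' un .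
      then show "weight (?S 1) y < \<beta>"
        using False w1 \<open>0 < \<beta>\<close> by (metis empty_iff insert_iff not_le)
      show "forcers G (?S 1) y = {}"
        using forcers_subset[of G "?S 1" y] filled1' spent1 by blast
    qed (use x filled1' verts_eq in auto)
    \<comment> \<open>The process has stopped at the centre, so the claimed inequality must fail
      too.\<close>
    moreover have "\<alpha>\<^sup>2 * ?m \<le> \<alpha> * ?m"
      using assms by (intro mult_right_mono) (auto simp: power2_eq_square mult_left_le)
    ultimately show ?thesis
      using False by auto
  next
    case True
    then have filled1': "filled (?S 1) = insert c ?B"
      using filled1 by auto
    then have un1: "verts G - filled (?S 1) = {x}"
      using x centre_notin by (auto simp: verts_eq)
    \<comment> \<open>The centre has only just been filled and is therefore not yet spent; the other
      filled vertices are leaves, not adjacent to \<open>x\<close>.\<close>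
    have f1: "forcers G (?S 1) x = {c}"
      using x centre_notin spent1 un1 filled1' unfolding forcers_def
      by (auto simp: arcs_ends_eq)
    have S2: "?S 2 = tf_step \<alpha> \<beta> G (?S 1)"
      by (simp add: numeral_2_eq_2)
    have n1: "next_weight \<alpha> G (?S 1) x = \<alpha>\<^sup>2 * ?m"
      using f1 un1 w1 by (simp add: next_weight_def power2_eq_square)
    have w2: "weight (?S 2) x = \<alpha>\<^sup>2 * ?m"
      using n1 by (simp add: S2 tf_step_def)
    have filled2: "filled (?S 2) = insert c ?B \<union> (if \<beta> \<le> \<alpha>\<^sup>2 * ?m then {x} else {})"
      unfolding S2 tf_step_def un1
      by (simp only: tf_state.simps filled1' singleton_iff Collect_conv_if n1)
    have spent2: "spent (?S 2) = insert c ?B"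
      unfolding S2 tf_step_def un1 by (simp only: tf_state.simps UN_insert UN_empty f1 spent1) simp
    show ?thesis
    proof (cases "\<beta> \<le> \<alpha>\<^sup>2 * ?m")
      case True
      then have "verts G \<subseteq> filled (?S 2)"
        using filled2 by (auto simp: verts_eq)
      then have "transmission_zero_forcing_set \<alpha> \<beta> G ?B"
        by (intro transmission_zero_forcing_setI) (auto simp: verts_eq)
      with True show ?thesis
        by simp
    next
      case False
      then have filled2': "filled (?S 2) = insert c ?B"
        using filled2 by simp
      have "\<not> transmission_zero_forcing_set \<alpha> \<beta> G ?B"
      proof (rule not_transmission_zero_forcing_set[where k = 2 and x = x])
        fix y assume "y \<in> verts G - filled (?S 2)"
        then have "y = x"
          using filled2' by (auto simp: verts_eq)
        then show "weight (?S 2) y < \<beta>"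
          using False w2 by simp
        show "forcers G (?S 2) y = {}"
          using forcers_subset[of G "?S 2" y] filled2' spent2 by blast
      qed (use x filled2' verts_eq \<open>c \<noteq> x\<close> in auto)
      with False show ?thesis
        by simp
    qed
  qed
qed

end

section \<open>The minimum in the three ranges of the threshold\<close>

theorem proposition4p1p2:
  fixes \<alpha> \<beta> :: real and n :: nat and G :: "('a,'b) pre_digraph"
  assumes "0 \<le> \<alpha>" "\<alpha> \<le> 1" and "0 < \<beta>" "\<beta> \<le> 1"
    and "n \<ge> 3"
    and "K\<^bsub>1,n - 1\<^esub> G"
  shows "(\<beta> \<le> (real n - 2) * \<alpha>^2 \<longrightarrow>
            transmission_zero_forcing_number \<alpha> \<beta> G = n - 2) \<and>
         ((real n - 2) * \<alpha>^2 < \<beta> \<and> \<beta> \<le> (real n - 1) * \<alpha> \<longrightarrow>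
            transmission_zero_forcing_number \<alpha> \<beta> G = n - 1) \<and>
         ((real n - 1) * \<alpha> < \<beta> \<longrightarrow>
            transmission_zero_forcing_number \<alpha> \<beta> G = n)"
proof -
  obtain U L where UL: "verts G = U \<union> L" "U \<inter> L = {}" "card U = 1" "card L = n - 1"
    "arcs_ends G = U \<times> L \<union> L \<times> U"
    using assms(6) by (auto simp: complete_bipartite_digraph_def)
  then obtain c where U: "U = {c}"
    by (auto simp: card_1_singleton_iff)
  \<comment> \<open>An infinite set would have \<open>card\<close> 0, but here it is at least
    2.\<close>
  have "finite L"
    using UL(4) \<open>n \<ge> 3\<close> card.infinite by fastforce
  then interpret star_digraph G c L
    using UL U by unfold_locales auto
  have fin: "finite (verts G)"
    using \<open>finite L\<close> by (simp add: verts_eq)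
  have card_verts: "card (verts G) = n"
    using UL(4) \<open>finite L\<close> centre_notin \<open>n \<ge> 3\<close> by (simp add: verts_eq)
  have card_but_leaf: "card (verts G - {x}) = n - 1" if "x \<in> L" for x
    using that card_verts by (simp add: verts_eq)
  have card_L_but_leaf: "card (L - {x}) = n - 2" if "x \<in> L" for x
    using that UL(4) by simp
  have leaves: "transmission_zero_forcing_set \<alpha> \<beta> G L \<longleftrightarrow> \<beta> \<le> (real n - 1) * \<alpha>"
    using transmission_zero_forcing_set_leaves[of \<beta> \<alpha>] \<open>0 < \<beta>\<close> \<open>n \<ge> 3\<close> UL(4)
    by (simp add: of_nat_diff mult.commute)
  have but_two: "transmission_zero_forcing_set \<alpha> \<beta> G (L - {x}) \<longleftrightarrow> \<beta> \<le> (real n - 2) * \<alpha>\<^sup>2"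
    if "x \<in> L" for x
    using transmission_zero_forcing_set_leaves_but_one[OF that assms(1-3)]
      card_L_but_leaf[OF that] \<open>n \<ge> 3\<close>
    by (simp add: of_nat_diff mult.commute)
  \<comment> \<open>This and \<open>sq_le\<close> below show that beyond
    \<open>(real n - 1) * \<alpha>\<close> the sets \<open>verts G - {y}\<close> and
    \<open>L - {y}\<close> fail along with \<open>L\<close>.\<close>
  have alpha_le: "\<alpha> \<le> (real n - 1) * \<alpha>"
    using mult_right_mono[of 1 "real n - 1" \<alpha>] assms by simp
  have "\<alpha>\<^sup>2 \<le> \<alpha>"
    using assms by (simp add: power2_eq_square mult_left_le)
  then have sq_le: "(real n - 2) * \<alpha>\<^sup>2 \<le> (real n - 1) * \<alpha>"
    using assms by (intro mult_mono) auto
  obtain x where x: "x \<in> L"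
    using UL(4) \<open>n \<ge> 3\<close> by fastforce
  show ?thesis
  proof (intro conjI impI)
    assume "\<beta> \<le> (real n - 2) * \<alpha>\<^sup>2"
    then show "transmission_zero_forcing_number \<alpha> \<beta> G = n - 2"
    proof (intro transmission_zero_forcing_number_eqI[OF fin, of _ _ "L - {x}"])
      fix B assume "transmission_zero_forcing_set \<alpha> \<beta> G B"
      then show "n - 2 \<le> card B"
        \<comment> \<open>All four candidates have at least \<open>n - 2\<close> elements, whether
          or not they are forcing.\<close>
        using \<open>0 < \<beta>\<close> by (cases rule: transmission_zero_forcing_set_cases)
          (auto simp: card_verts card_but_leaf card_L_but_leaf UL(4))
    qed (use x but_two card_L_but_leaf in auto)
  next
    assume *: "(real n - 2) * \<alpha>\<^sup>2 < \<beta> \<and> \<beta> \<le> (real n - 1) * \<alpha>"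
    then show "transmission_zero_forcing_number \<alpha> \<beta> G = n - 1"
    proof (intro transmission_zero_forcing_number_eqI[OF fin, of _ _ L])
      fix B assume B: "transmission_zero_forcing_set \<alpha> \<beta> G B"
      from this \<open>0 < \<beta>\<close> show "n - 1 \<le> card B"
      proof (cases rule: transmission_zero_forcing_set_cases)
        \<comment> \<open>Only this candidate is smaller than \<open>n - 1\<close>, and the strict
          lower bound on \<open>\<beta>\<close> excludes it.\<close>
        case (4 y)
        then show ?thesis
          using B * but_two by auto
      qed (auto simp: card_verts card_but_leaf UL(4))
    qed (use leaves UL(4) in auto)
  next
    assume *: "(real n - 1) * \<alpha> < \<beta>"
    show "transmission_zero_forcing_number \<alpha> \<beta> G = n"
    proof (rule transmission_zero_forcing_number_eqI[OF fin transmission_zero_forcing_set_verts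
          card_verts])
      fix B assume B: "transmission_zero_forcing_set \<alpha> \<beta> G B"
      from this \<open>0 < \<beta>\<close> show "n \<le> card B"
      proof (cases rule: transmission_zero_forcing_set_cases)
        case 2
        then show ?thesis
          using B * leaves by auto
      next
        case (3 y)
        then show ?thesis
          using B * alpha_le transmission_zero_forcing_set_all_but_leaf[OF _ \<open>0 < \<beta>\<close>] by auto
      next
        case (4 y)
        then show ?thesis
          using B * sq_le but_two by auto
      qed (simp add: card_verts)
    qed
  qed
qed

end
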